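(* Let $\mathscr{F}\subseteq\mathscr{P}(\omega)$ be a nonempty $\omega$-closed family. The semigroup $\boldsymbol{B}_{\omega}^{\mathscr{F}}$ is isomorphic to the semigroup of $\omega\times\omega$-matrix units $\boldsymbol{\mathcal{B}}_\omega$ if and only if $\mathscr{F}=\{F,\varnothing\}$ where $F$ is a one-point subset of $\omega$.
   Context: $\omega$ is the set of non-negative integers, $\mathscr{P}(\omega)$ its power set. For an integer $n$ and $F\subseteq\omega$ put $n+F=\{n+k\colon k\in F\}\subseteq\mathbb{Z}$ (empty if $F=\varnothing$). A family $\mathscr{F}\subseteq\mathscr{P}(\omega)$ is $\omega$-closed if $F_1\cap(-n+F_2)\in\mathscr{F}$ for all $n\in\omega$ and $F_1,F_2\in\mathscr{F}$. For an $\omega$-closed family $\mathscr{F}$, the set $\boldsymbol{B}_{\omega}\times\mathscr{F}=\omega\times\omega\times\mathscr{F}$ carries the semigroup operation $$(i_1,j_1,F_1)\cdot(i_2,j_2,F_2)=\begin{cases}(i_1-j_1+i_2,\,j_2,\,(j_1-i_2+F_1)\cap F_2), & j_1\leqslant i_2;\\ (i_1,\,j_1-i_2+j_2,\,F_1\cap(i_2-j_1+F_2)), & j_1\geqslant i_2.\end{cases}$$ If $\varnothing\notin\mathscr{F}$, then $\boldsymbol{B}_{\omega}^{\mathscr{F}}=(\boldsymbol{B}_{\omega}\times\mathscr{F},\cdot)$. If $\varnothing\in\mathscr{F}$, then $\boldsymbol{I}=\{(i,j,\varnothing)\colon i,j\in\omega\}$ is an ideal and $\boldsymbol{B}_{\omega}^{\mathscr{F}}$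 is the Rees quotient $(\boldsymbol{B}_{\omega}\times\mathscr{F},\cdot)/\boldsymbol{I}$, in which all $(i,j,\varnothing)$ are identified to a single zero element $\boldsymbol{0}$. The semigroup of $\omega\times\omega$-matrix units is $\boldsymbol{\mathcal{B}}_\omega=(\omega\times\omega)\sqcup\{0\}$ with $(a,b)\cdot(c,d)=(a,d)$ if $b=c$, $(a,b)\cdot(c,d)=0$ if $b\neq c$, and $(a,b)\cdot0=0\cdot(a,b)=0\cdot0=0$. *)

theory Defs
  imports Main
begin

text \<open>Elements of \<omega> have type \<^typ>\<open>nat\<close>, so \<^typ>\<open>nat set set\<close> is the type of families of
  subsets of \<omega>.\<close>

definition shift :: "int \<Rightarrow> nat set \<Rightarrow> int set" where
  "shift n F = {n + int k | k. k \<in> F}"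

text \<open>A shifted set may contain negative integers; it is only ever intersected with a subset of
  \<omega>, so its trace on \<omega> (the preimage under \<^term>\<open>int\<close>) is what matters.\<close>

abbreviation trace :: "int set \<Rightarrow> nat set" where
  "trace Z \<equiv> int -` Z"

definition omega_closed :: "nat set set \<Rightarrow> bool" where
  "omega_closed \<F> \<longleftrightarrow>
     (\<forall>n. \<forall>F1\<in>\<F>. \<forall>F2\<in>\<F>. F1 \<inter> trace (shift (- int n) F2) \<in> \<F>)"

record 'a sgrp =
  elems :: "'a set"
  op :: "'a \<Rightarrow> 'a \<Rightarrow> 'a"

definition sgrp_isomorphic :: "'a sgrp \<Rightarrow> 'b sgrp \<Rightarrow> bool" where
  "sgrp_isomorphic S T \<longleftrightarrow>
     (\<exists>h. bij_betw h (elems S) (elems T) \<and>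
          (\<forall>x\<in>elems S. \<forall>y\<in>elems S. h (op S x y) = op T (h x) (h y)))"

definition is_ideal :: "'a sgrp \<Rightarrow> 'a set \<Rightarrow> bool" where
  "is_ideal S I \<longleftrightarrow> I \<subseteq> elems S \<and>
     (\<forall>x\<in>elems S. \<forall>a\<in>I. op S x a \<in> I \<and> op S a x \<in> I)"

definition rees_cong :: "'a sgrp \<Rightarrow> 'a set \<Rightarrow> ('a \<times> 'a) set" where
  "rees_cong S I = {(x, y) \<in> elems S \<times> elems S. x = y \<or> (x \<in> I \<and> y \<in> I)}"

definition rees_quotient :: "'a sgrp \<Rightarrow> 'a set \<Rightarrow> 'a set sgrp" where
  "rees_quotient S I =
     \<lparr> elems = elems S // rees_cong S I,
       op = (\<lambda>X Y. rees_cong S I `` {op S x y | x y. x \<in> X \<and> y \<in> Y}) \<rparr>"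

type_synonym triple = "nat \<times> nat \<times> nat set"

text \<open>The first coordinates are written \<^term>\<open>i1 + i2 - j1\<close> and \<^term>\<open>j1 + j2 - i2\<close> so that the
  truncated subtraction on \<^typ>\<open>nat\<close> never truncates in the respective branch. For
  \<^prop>\<open>j1 = i2\<close> both branches give the same value.\<close>

fun triple_op :: "triple \<Rightarrow> triple \<Rightarrow> triple" where
  "triple_op (i1, j1, F1) (i2, j2, F2) =
     (if j1 \<le> i2
      then (i1 + i2 - j1, j2, trace (shift (int j1 - int i2) F1) \<inter> F2)
      else (i1, j1 + j2 - i2, F1 \<inter> trace (shift (int i2 - int j1) F2)))"

definition B_times :: "nat set set \<Rightarrow> triple sgrp" where
  "B_times \<F> = \<lparr> elems = UNIV \<times> UNIV \<times> \<F>, op = triple_op \<rparr>"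

definition empty_triples :: "triple set" where
  "empty_triples = {(i, j, {}) | i j. True}"

text \<open>To have one type in both cases, the elements are classes of triples also if the empty set
  is not in the family. Nothing is identified in that case, see \<open>B_F_iso_B_times\<close> below.\<close>

definition B_F :: "nat set set \<Rightarrow> triple set sgrp" where
  "B_F \<F> = (if {} \<in> \<F> then rees_quotient (B_times \<F>) empty_triples
                       else rees_quotient (B_times \<F>) {})"

fun matrix_unit_op :: "(nat \<times> nat) option \<Rightarrow> (nat \<times> nat) option \<Rightarrow> (nat \<times> nat) option" where
  "matrix_unit_op (Some (a, b)) (Some (c, d)) = (if b = c then Some (a, d) else None)"
| "matrix_unit_op None _ = None"
| "matrix_unit_op _ None = None"

text \<open>The zero is \<^term>\<open>None\<close>.\<close>

definition matrix_units :: "(nat \<times> nat) option sgrp" where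
  "matrix_units = \<lparr> elems = UNIV, op = matrix_unit_op \<rparr>"

lemma B_times_closed:
  assumes "omega_closed \<F>" "x \<in> elems (B_times \<F>)" "y \<in> elems (B_times \<F>)"
  shows "op (B_times \<F>) x y \<in> elems (B_times \<F>)"
proof -
  obtain i1 j1 F1 i2 j2 F2 where xy: "x = (i1, j1, F1)" "y = (i2, j2, F2)"
    by (metis prod_cases3)
  have cl: "A \<inter> trace (shift (- int n) C) \<in> \<F>" if "A \<in> \<F>" "C \<in> \<F>" for n A C
    using assms(1) that by (simp add: omega_closed_def)
  have F: "F1 \<in> \<F>" "F2 \<in> \<F>"
    using assms xy by (auto simp: B_times_def)
  show ?thesis
    using cl[OF F(2,1), of "i2 - j1"] cl[OF F, of "j1 - i2"]
    by (auto simp: xy B_times_def of_nat_diff Int_commute)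
qed

lemma trace_shift_nonpos:
  assumes "a \<le> b"
  shows "trace (shift (int a - int b) F) = {k. k + (b - a) \<in> F}"
proof -
  have "int k \<in> shift (int a - int b) F \<longleftrightarrow> k + (b - a) \<in> F" for k
  proof
    assume "int k \<in> shift (int a - int b) F"
    then obtain l where l: "l \<in> F" "int k = int a - int b + int l"
      by (auto simp: shift_def)
    then have "l = k + (b - a)"
      using assms by linarith
    then show "k + (b - a) \<in> F"
      using l by simp
  next
    assume "k + (b - a) \<in> F"
    moreover have "int k = int a - int b + int (k + (b - a))"
      using assms by linarith
    ultimately show "int k \<in> shift (int a - int b) F"
      unfolding shift_def by blast
  qed
  then show ?thesis
    by auto
qed

lemma triple_op_nat:
  "triple_op (i1, j1, F1) (i2, j2, F2) =
     (if j1 \<le> i2 then (i1 + i2 - j1, j2, {k. k + (i2 - j1) \<in> F1} \<inter> F2)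
      else (i1, j1 + j2 - i2, F1 \<inter> {k. k + (j1 - i2) \<in> F2}))"
  by (simp add: trace_shift_nonpos)

lemma triple_op_assoc: "triple_op (triple_op x y) z = triple_op x (triple_op y z)"
proof -
  obtain i1 j1 F1 i2 j2 F2 i3 j3 F3
    where xyz: "x = (i1, j1, F1)" "y = (i2, j2, F2)" "z = (i3, j3, F3)"
    by (metis prod_cases3)
  consider "j1 \<le> i2" "j2 \<le> i3" | "j1 \<le> i2" "\<not> j2 \<le> i3"
    | "\<not> j1 \<le> i2" "\<not> j2 \<le> i3"
    | "\<not> j1 \<le> i2" "j2 \<le> i3" "j1 + j2 \<le> i2 + i3"
    | "\<not> j1 \<le> i2" "j2 \<le> i3" "\<not> j1 + j2 \<le> i2 + i3"
    by linarith
  then show ?thesis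
    by cases (auto simp: xyz triple_op_nat ac_simps simp del: triple_op.simps)
qed

lemma empty_triples_ideal:
  assumes "{} \<in> \<F>"
  shows "is_ideal (B_times \<F>) empty_triples"
  using assms by (auto simp: is_ideal_def B_times_def empty_triples_def shift_def)

lemma rees_op_class:
  assumes "is_ideal S I" "x \<in> elems S" "y \<in> elems S" "op S x y \<in> elems S"
  shows "op (rees_quotient S I) (rees_cong S I `` {x}) (rees_cong S I `` {y})
       = rees_cong S I `` {op S x y}"
  using assms by (auto simp: rees_quotient_def rees_cong_def is_ideal_def)

lemma B_F_iso_B_times:
  assumes "omega_closed \<F>" "{} \<notin> \<F>"
  shows "sgrp_isomorphic (B_times \<F>) (B_F \<F>)"
proof -
  let ?S = "B_times \<F>"
  let ?h = "\<lambda>x. rees_cong ?S {} `` {x}"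
  have h: "?h x = {x}" if "x \<in> elems ?S" for x
    using that by (auto simp: rees_cong_def)
  have "elems (B_F \<F>) = ?h ` elems ?S"
    using assms(2) by (auto simp: B_F_def rees_quotient_def quotient_def)
  then have "bij_betw ?h (elems ?S) (elems (B_F \<F>))"
    by (auto simp: bij_betw_def inj_on_def h)
  moreover have "is_ideal ?S {}"
    by (simp add: is_ideal_def)
  ultimately show ?thesis
    using assms B_times_closed[OF assms(1)] rees_op_class[of ?S "{}"]
    unfolding sgrp_isomorphic_def B_F_def by (intro exI[of _ ?h]) auto
qed

end

theory Submission
  imports Defs
begin

text \<open>An isomorphism from the Rees quotient onto the matrix units is the same thing as a surjective
  homomorphism \<open>g\<close> on triples that identifies exactly the triples with empty third component
  (\<open>rees_quotient_iso_iff\<close>, \<open>B_F_iso_iff\<close>), so the proof never computes with classes.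

  Over \<open>{{a}, {}}\<close>, a product of two triples with third component \<open>{a}\<close> again has third component
  \<open>{a}\<close> if the adjacent indices agree; otherwise one of the two copies of \<open>{a}\<close> is moved off the
  other and the product is a zero. This is the multiplication of matrix units.

  Conversely, two features of the matrix units force this shape of the family. They have a zero,
  whereas a triple \<open>(i, j, G)\<close> with \<open>G\<close> nonempty is not even a left zero; so \<open>{}\<close> lies in the family.
  And distinct nonzero idempotents of the matrix units are orthogonal. If \<open>A\<close> and \<open>B\<close> are members
  of the family with \<open>b + n \<in> A\<close> and \<open>b \<in> B\<close>, then the product of the idempotents \<open>(0, 0, A)\<close> and
  \<open>(n, n, B)\<close> has \<open>b\<close> in its third component, so it is nonzero, and the two idempotents are equal:
  \<open>n = 0\<close> and \<open>A = B\<close>. Hence all nonempty members of the family are one and the same singleton; there is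
  one, since otherwise the quotient would be trivial.\<close>

text \<open>The universal property of the quotient: a bijection on classes corresponds to a map on the
  semigroup whose kernel is the Rees congruence.\<close>

lemma rees_quotient_iso_iff:
  assumes "is_ideal S I"
    and closed: "\<And>x y. x \<in> elems S \<Longrightarrow> y \<in> elems S \<Longrightarrow> op S x y \<in> elems S"
  shows "sgrp_isomorphic (rees_quotient S I) T \<longleftrightarrow>
    (\<exists>g. g ` elems S = elems T \<and>
         (\<forall>x\<in>elems S. \<forall>y\<in>elems S. g x = g y \<longleftrightarrow> x = y \<or> x \<in> I \<and> y \<in> I) \<and>
         (\<forall>x\<in>elems S. \<forall>y\<in>elems S. g (op S x y) = op T (g x) (g y)))"
    (is "?L \<longleftrightarrow> ?R")
proof -
  let ?Q = "rees_quotient S I"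
  let ?c = "\<lambda>x. rees_cong S I `` {x}"
  have elemsQ: "elems ?Q = ?c ` elems S"
    by (auto simp: rees_quotient_def quotient_def)
  have class_eq: "?c x = ?c y \<longleftrightarrow> x = y \<or> x \<in> I \<and> y \<in> I" if "x \<in> elems S" "y \<in> elems S" for x y
    using that by (auto simp: rees_cong_def)
  have opQ: "op ?Q (?c x) (?c y) = ?c (op S x y)" if "x \<in> elems S" "y \<in> elems S" for x y
    using rees_op_class[OF assms(1)] closed that by blast
  show ?thesis
  proof
    assume ?L
    then obtain h where h: "bij_betw h (elems ?Q) (elems T)"
      "\<forall>X\<in>elems ?Q. \<forall>Y\<in>elems ?Q. h (op ?Q X Y) = op T (h X) (h Y)"
      unfolding sgrp_isomorphic_def by blast
    define g where "g = (\<lambda>x. h (?c x))"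
    have "g ` elems S = elems T"
      using h(1) by (simp add: g_def bij_betw_def elemsQ image_image)
    moreover have "g x = g y \<longleftrightarrow> x = y \<or> x \<in> I \<and> y \<in> I" if "x \<in> elems S" "y \<in> elems S" for x y
    proof -
      have "g x = g y \<longleftrightarrow> ?c x = ?c y"
        unfolding g_def using h(1) that by (intro inj_on_eq_iff) (auto simp: bij_betw_def elemsQ)
      then show ?thesis
        using class_eq[OF that] by blast
    qed
    moreover have "g (op S x y) = op T (g x) (g y)" if "x \<in> elems S" "y \<in> elems S" for x y
    proof -
      have "h (op ?Q (?c x) (?c y)) = op T (h (?c x)) (h (?c y))"
        using h(2) that unfolding elemsQ by blast
      then show ?thesis
        unfolding g_def opQ[OF that] .
    qed
    ultimately show ?R
      by blast
  next
    assume ?R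
    then obtain g where g: "g ` elems S = elems T"
      "\<And>x y. x \<in> elems S \<Longrightarrow> y \<in> elems S \<Longrightarrow> g x = g y \<longleftrightarrow> x = y \<or> x \<in> I \<and> y \<in> I"
      "\<And>x y. x \<in> elems S \<Longrightarrow> y \<in> elems S \<Longrightarrow> g (op S x y) = op T (g x) (g y)"
      by blast
    define h where "h X = g (SOME x. x \<in> X)" for X
    have h: "h (?c x) = g x" if "x \<in> elems S" for x
    proof -
      have "x \<in> ?c x"
        using that by (simp add: rees_cong_def)
      then have "(SOME y. y \<in> ?c x) \<in> ?c x"
        by (rule someI)
      then show ?thesis
        using g(2) that unfolding h_def by (auto simp: rees_cong_def)
    qed
    have "bij_betw h (elems ?Q) (elems T)"
      unfolding bij_betw_def
    proof
      show "inj_on h (elems ?Q)"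
      proof (rule inj_onI)
        fix X Y
        assume "X \<in> elems ?Q" "Y \<in> elems ?Q" and eq: "h X = h Y"
        then obtain x y where xy: "x \<in> elems S" "X = ?c x" "y \<in> elems S" "Y = ?c y"
          unfolding elemsQ by blast
        then have "g x = g y"
          using h eq by simp
        then show "X = Y"
          using xy g(2) class_eq by simp
      qed
      show "h ` elems ?Q = elems T"
        using h g(1) by (simp add: elemsQ image_image)
    qed
    moreover have "\<forall>X\<in>elems ?Q. \<forall>Y\<in>elems ?Q. h (op ?Q X Y) = op T (h X) (h Y)"
      using opQ h closed g(3) unfolding elemsQ by simp
    ultimately show ?L
      unfolding sgrp_isomorphic_def by blast
  qed
qed

text \<open>The ideal of triples with empty third component is empty if \<open>{}\<close> is not in the family, which
  makes the two cases in the definition of \<^const>\<open>B_F\<close> instances of one description.\<close>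

lemma B_F_iso_iff:
  assumes "omega_closed \<F>"
  shows "sgrp_isomorphic (B_F \<F>) T \<longleftrightarrow>
    (\<exists>g. g ` (UNIV \<times> UNIV \<times> \<F>) = elems T \<and>
         (\<forall>x \<in> UNIV \<times> UNIV \<times> \<F>. \<forall>y \<in> UNIV \<times> UNIV \<times> \<F>.
            g x = g y \<longleftrightarrow> x = y \<or> snd (snd x) = {} \<and> snd (snd y) = {}) \<and>
         (\<forall>x \<in> UNIV \<times> UNIV \<times> \<F>. \<forall>y \<in> UNIV \<times> UNIV \<times> \<F>.
            g (triple_op x y) = op T (g x) (g y)))"
proof -
  let ?I = "{x \<in> elems (B_times \<F>). snd (snd x) = {}}"
  have eq: "B_F \<F> = rees_quotient (B_times \<F>) ?I"
  proof (cases "{} \<in> \<F>")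
    case True
    then have "?I = empty_triples"
      by (auto simp: B_times_def empty_triples_def)
    with True show ?thesis
      by (simp add: B_F_def)
  next
    case False
    then have "?I = {}"
      by (auto simp: B_times_def)
    with False show ?thesis
      by (simp only: B_F_def if_False)
  qed
  have ideal: "is_ideal (B_times \<F>) ?I"
    by (auto simp: is_ideal_def B_times_def shift_def)
  show ?thesis
    unfolding eq
  proof (subst rees_quotient_iso_iff[OF ideal])
    show "op (B_times \<F>) x y \<in> elems (B_times \<F>)"
      if "x \<in> elems (B_times \<F>)" "y \<in> elems (B_times \<F>)" for x y
      using B_times_closed[OF assms] that .
  qed (simp add: B_times_def del: triple_op.simps)
qed

lemma singleton_family_iso:
  assumes "omega_closed {{a}, {}}"
  shows "sgrp_isomorphic (B_F {{a}, {}}) matrix_units"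
proof -
  let ?X = "UNIV \<times> UNIV \<times> {{a}, {}} :: triple set"
  define g :: "triple \<Rightarrow> (nat \<times> nat) option"
    where "g = (\<lambda>(i, j, G). if G = {} then None else Some (i, j))"
  have "g ` ?X = UNIV"
  proof -
    have "u \<in> g ` ?X" for u
    proof (cases u)
      case None
      then show ?thesis
        by (intro image_eqI[of _ _ "(0, 0, {})"]) (auto simp: g_def)
    next
      case (Some p)
      then show ?thesis
        by (intro image_eqI[of _ _ "(fst p, snd p, {a})"]) (auto simp: g_def)
    qed
    then show ?thesis
      by blast
  qed
  moreover have "\<forall>x\<in>?X. \<forall>y\<in>?X. g x = g y \<longleftrightarrow> x = y \<or> snd (snd x) = {} \<and> snd (snd y) = {}"
    by (auto simp: g_def)
  moreover have "\<forall>x\<in>?X. \<forall>y\<in>?X. g (triple_op x y) = matrix_unit_op (g x) (g y)"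
    by (auto simp: g_def triple_op_nat simp del: triple_op.simps)
  ultimately show ?thesis
    unfolding B_F_iso_iff[OF assms] matrix_units_def sgrp.simps by (intro exI[of _ g] conjI)
qed

lemma matrix_unit_idempotents_orthogonal:
  assumes "matrix_unit_op u u = u" "matrix_unit_op v v = v" "u \<noteq> v"
  shows "matrix_unit_op u v = None"
  using assms by (cases u; cases v) (auto split: if_splits)

theorem mainTheorem10:
  fixes \<F> :: "nat set set"
  assumes "\<F> \<noteq> {}" and "omega_closed \<F>"
  shows "sgrp_isomorphic (B_F \<F>) matrix_units \<longleftrightarrow> (\<exists>F. is_singleton F \<and> \<F> = {F, {}})"
proof
  assume "\<exists>F. is_singleton F \<and> \<F> = {F, {}}"
  then show "sgrp_isomorphic (B_F \<F>) matrix_units"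
    using assms(2) singleton_family_iso by (auto elim!: is_singletonE)
next
  let ?X = "UNIV \<times> UNIV \<times> \<F> :: triple set"
  assume "sgrp_isomorphic (B_F \<F>) matrix_units"
  then obtain g where surj: "g ` ?X = UNIV"
    and ker: "\<forall>x\<in>?X. \<forall>y\<in>?X. g x = g y \<longleftrightarrow> x = y \<or> snd (snd x) = {} \<and> snd (snd y) = {}"
    and op: "\<forall>x\<in>?X. \<forall>y\<in>?X. g (triple_op x y) = matrix_unit_op (g x) (g y)"
    unfolding B_F_iso_iff[OF assms(2)] matrix_units_def sgrp.simps by (elim exE conjE)
  note kernel = ker[THEN bspec, THEN bspec] and hom = op[THEN bspec, THEN bspec]
  have zero_empty: "G = {}" if "g (i, j, G) = None" "G \<in> \<F>" for i j G
  proof (rule ccontr)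
    assume "G \<noteq> {}"
    \<comment> \<open>A factor that moves \<open>(i, j, G)\<close> without shrinking \<open>G\<close>, against the absorbing law of
      the zero.\<close>
    have "triple_op (i, j, G) (j, Suc j, G) = (i, Suc j, G)"
      by (simp add: triple_op_nat del: triple_op.simps)
    then have "g (i, Suc j, G) = g (i, j, G)"
      using hom[of "(i, j, G)" "(j, Suc j, G)"] that by simp
    then show False
      using kernel[of "(i, Suc j, G)" "(i, j, G)"] that \<open>G \<noteq> {}\<close> by simp
  qed
  have "None \<in> g ` ?X"
    using surj by simp
  then have empty: "{} \<in> \<F>"
    using zero_empty by (auto simp: eq_commute)
  have "\<F> \<noteq> {{}}"
  proof
    assume "\<F> = {{}}"
    have "None \<in> g ` ?X" "Some (0, 0) \<in> g ` ?X"
      unfolding surj by simp_all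
    then obtain x y where xy: "None = g x" "x \<in> ?X" "Some (0, 0) = g y" "y \<in> ?X"
      by (elim imageE) (rule that)
    then have "g x = g y"
      using kernel[of x y] \<open>\<F> = {{}}\<close> by (simp add: mem_Times_iff)
    then show False
      using xy by (metis option.distinct(1))
  qed
  then obtain F a where F: "F \<in> \<F>" "a \<in> F"
    using empty by blast
  have idem: "matrix_unit_op (g (n, n, A)) (g (n, n, A)) = g (n, n, A)" if "A \<in> \<F>" for n A
  proof -
    have "triple_op (n, n, A) (n, n, A) = (n, n, A)"
      by (simp add: triple_op_nat del: triple_op.simps)
    moreover have "g (triple_op (n, n, A) (n, n, A)) = matrix_unit_op (g (n, n, A)) (g (n, n, A))"
      using that by (intro hom) auto
    ultimately show ?thesis
      by (simp only:)
  qed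
  have overlap: "n = 0 \<and> A = B" if "A \<in> \<F>" "B \<in> \<F>" "b + n \<in> A" "b \<in> B" for A B b n
  proof (rule ccontr)
    assume "\<not> (n = 0 \<and> A = B)"
    then have "g (0, 0, A) \<noteq> g (n, n, B)"
      using kernel[of "(0, 0, A)" "(n, n, B)"] that by auto
    then have "matrix_unit_op (g (0, 0, A)) (g (n, n, B)) = None"
      using idem that by (intro matrix_unit_idempotents_orthogonal)
    moreover have "g (triple_op (0, 0, A) (n, n, B)) = matrix_unit_op (g (0, 0, A)) (g (n, n, B))"
      using that by (intro hom) auto
    ultimately have "g (triple_op (0, 0, A) (n, n, B)) = None"
      by (simp only:)
    then have "g (n, n, {k. k + n \<in> A} \<inter> B) = None"
      by (simp add: triple_op_nat del: triple_op.simps)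
    moreover have "{k. k + n \<in> A} \<inter> B \<in> \<F>"
      using B_times_closed[OF assms(2), of "(0, 0, A)" "(n, n, B)"] that
      by (simp add: B_times_def triple_op_nat del: triple_op.simps)
    ultimately have "{k. k + n \<in> A} \<inter> B = {}"
      by (rule zero_empty)
    then show False
      using that by blast
  qed
  have unique: "b = a \<and> B = F" if "B \<in> \<F>" "b \<in> B" for B b
  proof (cases "b \<le> a")
    case True
    then show ?thesis
      using overlap[of F B b "a - b"] F that by simp
  next
    case False
    then show ?thesis
      using overlap[of B F a "b - a"] F that by simp
  qed
  have "F = {a}"
    using unique[OF F(1)] F by blast
  moreover have "\<F> = {F, {}}"
    using unique F empty by blast
  ultimately show "\<exists>F. is_singleton F \<and> \<F> = {F, {}}"
    by (auto simp: is_singleton_def)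
qed

end
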